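(* Let $\Delta t>0$ be the time-step size. The discrete point queue models PQM1-D and PQM2-D are always well-defined with any $\Delta t$; PQM3-D is well-defined if and only if $\Delta t\le\frac{\Lambda}{\sigma(t)}$; and PQM4-D is well-defined if and only if $\Delta t\le\frac{\Lambda}{\delta(t)}$. Thus, when $$\Delta t\le\frac{\Lambda}{\max_t\{\delta(t),\sigma(t)\}},$$ all four discrete models are well-defined.
   Context: A point queue has storage capacity $\Lambda>0$, origin demand $\delta(t)\ge0$ and destination supply $\sigma(t)\ge0$. The queue size is $\lambda(t)=F(t)-G(t)$, where $F,G$ are the cumulative in- and out-flows. Conditions such as $\Delta t\le\Lambda/\sigma(t)$ are required at every time step $t$, with $\Lambda/0=\infty$. Discrete demands and supplies over $[t,t+\Delta t]$: - PQM1-D: $d(t)\Delta t=\delta(t)\Delta t+\lambda(t)$, $s(t)\Delta t=\sigma(t)\Delta t+\Lambda-\lambda(t)$; - PQM2-D: $d(t)\Delta t=\lambda(t)$, $s(t)\Delta t=\Lambda-\lambda(t)$; - PQM3-D: $d(t)\Delta t=\delta(t)\Delta t+\lambda(t)$, $s(t)\Delta t=\Lambda-\lambda(t)$; - PQM4-D: $d(t)\Delta t=\lambda(t)$, $s(t)\Delta t=\sigma(t)\Delta t+\Lambda-\lambda(t)$. Each model has two formulations: (A) $\lambda(t+\Delta t)=\lambda(t)+\min\{\delta(t)\Delta t,s(t)\Delta t\}-\min\{d(t)\Delta t,\sigma(t)\Delta t\}$; (B) $F(t+\Delta t)=F(t)+\min\{\delta(t)\Delta t,s(t)\Delta t\}$,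 $G(t+\Delta t)=G(t)+\min\{d(t)\Delta t,\sigma(t)\Delta t\}$, with $\lambda=F-G$. A discrete model in formulation (A) is well-defined if and only if $\lambda(t+\Delta t)$ is between $0$ and $\Lambda$ for (every) $\lambda(t)$ between $0$ and $\Lambda$. A discrete model in formulation (B) is well-defined if and only if $G(t+\Delta t)\le F(t+\Delta t)\le G(t+\Delta t)+\Lambda$ for (all) $G(t)\le F(t)\le G(t)+\Lambda$. Data not appearing in a stated condition are arbitrary: the "if and only if" for PQM3-D concerns well-definedness for given $\sigma$ and all origin demands $\delta\ge0$; the one for PQM4-D concerns well-definedness for given $\delta$ and all destination supplies $\sigma\ge0$; PQM1-D and PQM2-D are well-defined for all $\delta,\sigma\ge0$. *)

theory Defs
  imports Complex_Main "HOL-Library.Extended_Real"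
begin

datatype pqm = PQM1 | PQM2 | PQM3 | PQM4

datatype formulation = Form_A | Form_B

definition time_steps :: "real \<Rightarrow> real set" where
  "time_steps \<Delta>t = {real k * \<Delta>t | k :: nat. True}"

text \<open>
  Discrete demand \<open>d\<close> and supply \<open>s\<close> of the queue over one step. They are rates, so the model
  equations, which prescribe \<open>d \<Delta>t\<close> and \<open>s \<Delta>t\<close>, are divided by \<open>\<Delta>t\<close>. The arguments
  \<open>\<delta>\<close>, \<open>\<sigma>\<close>, \<open>q\<close> are the values at the current time step; \<open>q\<close> is the queue size.
\<close>

fun disc_demand :: "pqm \<Rightarrow> real \<Rightarrow> real \<Rightarrow> real \<Rightarrow> real" where
  "disc_demand PQM1 \<Delta>t \<delta> q = (\<delta> * \<Delta>t + q) / \<Delta>t"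
| "disc_demand PQM2 \<Delta>t \<delta> q = q / \<Delta>t"
| "disc_demand PQM3 \<Delta>t \<delta> q = (\<delta> * \<Delta>t + q) / \<Delta>t"
| "disc_demand PQM4 \<Delta>t \<delta> q = q / \<Delta>t"

fun disc_supply :: "pqm \<Rightarrow> real \<Rightarrow> real \<Rightarrow> real \<Rightarrow> real \<Rightarrow> real" where
  "disc_supply PQM1 \<Lambda> \<Delta>t \<sigma> q = (\<sigma> * \<Delta>t + \<Lambda> - q) / \<Delta>t"
| "disc_supply PQM2 \<Lambda> \<Delta>t \<sigma> q = (\<Lambda> - q) / \<Delta>t"
| "disc_supply PQM3 \<Lambda> \<Delta>t \<sigma> q = (\<Lambda> - q) / \<Delta>t"
| "disc_supply PQM4 \<Lambda> \<Delta>t \<sigma> q = (\<sigma> * \<Delta>t + \<Lambda> - q) / \<Delta>t"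

definition inflow :: "pqm \<Rightarrow> real \<Rightarrow> real \<Rightarrow> real \<Rightarrow> real \<Rightarrow> real \<Rightarrow> real" where
  "inflow m \<Lambda> \<Delta>t \<delta> \<sigma> q = min (\<delta> * \<Delta>t) (disc_supply m \<Lambda> \<Delta>t \<sigma> q * \<Delta>t)"

definition outflow :: "pqm \<Rightarrow> real \<Rightarrow> real \<Rightarrow> real \<Rightarrow> real \<Rightarrow> real" where
  "outflow m \<Delta>t \<delta> \<sigma> q = min (disc_demand m \<Delta>t \<delta> q * \<Delta>t) (\<sigma> * \<Delta>t)"

definition step_A ::
  "pqm \<Rightarrow> real \<Rightarrow> real \<Rightarrow> (real \<Rightarrow> real) \<Rightarrow> (real \<Rightarrow> real) \<Rightarrow> (real \<Rightarrow> real) \<Rightarrow> real \<Rightarrow> bool" where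
  "step_A m \<Lambda> \<Delta>t \<delta> \<sigma> q t \<longleftrightarrow>
     q (t + \<Delta>t) = q t + inflow m \<Lambda> \<Delta>t (\<delta> t) (\<sigma> t) (q t) - outflow m \<Delta>t (\<delta> t) (\<sigma> t) (q t)"

definition step_B ::
  "pqm \<Rightarrow> real \<Rightarrow> real \<Rightarrow> (real \<Rightarrow> real) \<Rightarrow> (real \<Rightarrow> real) \<Rightarrow>
    (real \<Rightarrow> real) \<Rightarrow> (real \<Rightarrow> real) \<Rightarrow> real \<Rightarrow> bool" where
  "step_B m \<Lambda> \<Delta>t \<delta> \<sigma> F G t \<longleftrightarrow>
     F (t + \<Delta>t) = F t + inflow m \<Lambda> \<Delta>t (\<delta> t) (\<sigma> t) (F t - G t) \<and>
     G (t + \<Delta>t) = G t + outflow m \<Delta>t (\<delta> t) (\<sigma> t) (F t - G t)"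

text \<open>
  Well-definedness for given \<open>\<delta>\<close> and \<open>\<sigma>\<close>. The update equation is imposed only at the step
  \<open>t\<close> under consideration: every admissible state at time \<open>t\<close> has to be tested, whether or not
  it can be reached from an admissible state at an earlier time.
\<close>

fun well_defined ::
  "formulation \<Rightarrow> pqm \<Rightarrow> real \<Rightarrow> real \<Rightarrow> (real \<Rightarrow> real) \<Rightarrow> (real \<Rightarrow> real) \<Rightarrow> bool" where
  "well_defined Form_A m \<Lambda> \<Delta>t \<delta> \<sigma> \<longleftrightarrow>
     (\<forall>t \<in> time_steps \<Delta>t. \<forall>q. step_A m \<Lambda> \<Delta>t \<delta> \<sigma> q t \<longrightarrow>
        0 \<le> q t \<and> q t \<le> \<Lambda> \<longrightarrow>
        0 \<le> q (t + \<Delta>t) \<and> q (t + \<Delta>t) \<le> \<Lambda>)"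
| "well_defined Form_B m \<Lambda> \<Delta>t \<delta> \<sigma> \<longleftrightarrow>
     (\<forall>t \<in> time_steps \<Delta>t. \<forall>F G. step_B m \<Lambda> \<Delta>t \<delta> \<sigma> F G t \<longrightarrow>
        G t \<le> F t \<and> F t \<le> G t + \<Lambda> \<longrightarrow>
        G (t + \<Delta>t) \<le> F (t + \<Delta>t) \<and> F (t + \<Delta>t) \<le> G (t + \<Delta>t) + \<Lambda>)"

definition nonneg_at_steps :: "real \<Rightarrow> (real \<Rightarrow> real) \<Rightarrow> bool" where
  "nonneg_at_steps \<Delta>t f \<longleftrightarrow> (\<forall>t \<in> time_steps \<Delta>t. 0 \<le> f t)"

text \<open>
  Step-size bounds of the form \<open>\<Delta>t \<le> \<Lambda> / x\<close> are to be stated in \<^typ>\<open>ereal\<close>, where \<open>\<Lambda> / 0 = \<infinity>\<close>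
  for \<open>\<Lambda> > 0\<close>; in \<^typ>\<open>real\<close> the quotient would be \<open>0\<close>.
\<close>

end

theory Submission imports Defs begin

text \<open>
  Well-definedness of either formulation says that the one-step update map sends \<open>[0, \<Lambda>]\<close> into
  itself at every time step. PQM1 and PQM2 always do. PQM3 can only fail at the lower end: the
  queue is full, inflow is blocked, and more than \<open>\<Lambda>\<close> leaves; taking \<open>\<delta> = \<sigma>\<close> and
  the state \<open>\<Lambda>\<close> realises this as soon as \<open>\<sigma> \<Delta>t > \<Lambda>\<close>. PQM4 is dual: the extremal case is an
  empty queue with \<open>\<sigma> = \<delta>\<close>.
\<close>

definition queue_update :: "pqm \<Rightarrow> real \<Rightarrow> real \<Rightarrow> real \<Rightarrow> real \<Rightarrow> real \<Rightarrow> real" where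
  "queue_update m \<Lambda> \<Delta>t \<delta> \<sigma> x = x + inflow m \<Lambda> \<Delta>t \<delta> \<sigma> x - outflow m \<Delta>t \<delta> \<sigma> x"

text \<open>The step equation constrains a trajectory only at \<open>t\<close> and
  \<open>t + \<Delta>t\<close>, which differ since \<open>\<Delta>t > 0\<close>, so every state in
  \<open>[0, \<Lambda>]\<close> is the value at \<open>t\<close> of some trajectory. Both flows
  depend on \<open>F\<close> and \<open>G\<close> only through \<open>F - G\<close>, so the two
  formulations share one map.\<close>

lemma well_defined_iff_update:
  assumes "\<Delta>t > 0"
  shows "well_defined form m \<Lambda> \<Delta>t \<delta> \<sigma> \<longleftrightarrow>
    (\<forall>t \<in> time_steps \<Delta>t. \<forall>x \<in> {0..\<Lambda>}. queue_update m \<Lambda> \<Delta>t (\<delta> t) (\<sigma> t) x \<in> {0..\<Lambda>})"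
    (is "_ \<longleftrightarrow> ?update")
proof (cases form)
  case Form_A
  have "?update" if wd: "well_defined Form_A m \<Lambda> \<Delta>t \<delta> \<sigma>"
  proof (intro ballI)
    fix t x assume t: "t \<in> time_steps \<Delta>t" and x: "x \<in> {0..\<Lambda>}"
    let ?q = "(\<lambda>_. queue_update m \<Lambda> \<Delta>t (\<delta> t) (\<sigma> t) x)(t := x)"
    have "step_A m \<Lambda> \<Delta>t \<delta> \<sigma> ?q t"
      using assms by (simp add: step_A_def queue_update_def)
    then have "0 \<le> ?q (t + \<Delta>t) \<and> ?q (t + \<Delta>t) \<le> \<Lambda>"
      using wd t x unfolding well_defined.simps by fastforce
    then show "queue_update m \<Lambda> \<Delta>t (\<delta> t) (\<sigma> t) x \<in> {0..\<Lambda>}"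
      using assms by simp
  qed
  moreover have "well_defined Form_A m \<Lambda> \<Delta>t \<delta> \<sigma>" if ?update
    using that by (simp add: step_A_def queue_update_def)
  ultimately show ?thesis using Form_A by blast
next
  case Form_B
  have "?update" if wd: "well_defined Form_B m \<Lambda> \<Delta>t \<delta> \<sigma>"
  proof (intro ballI)
    fix t x assume t: "t \<in> time_steps \<Delta>t" and x: "x \<in> {0..\<Lambda>}"
    \<comment> \<open>Normalising \<open>G t\<close> to 0 makes \<open>F t\<close> itself the queue
      size \<open>x\<close>.\<close>
    let ?F = "(\<lambda>_. x + inflow m \<Lambda> \<Delta>t (\<delta> t) (\<sigma> t) x)(t := x)"
    let ?G = "(\<lambda>_. outflow m \<Delta>t (\<delta> t) (\<sigma> t) x)(t := 0)"
    have "step_B m \<Lambda> \<Delta>t \<delta> \<sigma> ?F ?G t"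
      using assms by (simp add: step_B_def)
    moreover have "?G t \<le> ?F t \<and> ?F t \<le> ?G t + \<Lambda>"
      using x by simp
    ultimately have "?G (t + \<Delta>t) \<le> ?F (t + \<Delta>t) \<and> ?F (t + \<Delta>t) \<le> ?G (t + \<Delta>t) + \<Lambda>"
      using wd t unfolding well_defined.simps by blast
    then show "queue_update m \<Lambda> \<Delta>t (\<delta> t) (\<sigma> t) x \<in> {0..\<Lambda>}"
      using assms by (simp add: queue_update_def)
  qed
  moreover have "well_defined Form_B m \<Lambda> \<Delta>t \<delta> \<sigma>" if upd: ?update
    unfolding well_defined.simps
  proof (intro ballI allI impI)
    fix t F G
    assume t: "t \<in> time_steps \<Delta>t" and step: "step_B m \<Lambda> \<Delta>t \<delta> \<sigma> F G t"
      and "G t \<le> F t \<and> F t \<le> G t + \<Lambda>"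
    then have "F t - G t \<in> {0..\<Lambda>}" by simp
    then have "queue_update m \<Lambda> \<Delta>t (\<delta> t) (\<sigma> t) (F t - G t) \<in> {0..\<Lambda>}"
      using upd t by blast
    with step show "G (t + \<Delta>t) \<le> F (t + \<Delta>t) \<and> F (t + \<Delta>t) \<le> G (t + \<Delta>t) + \<Lambda>"
      by (simp add: step_B_def queue_update_def)
  qed
  ultimately show ?thesis using Form_B by blast
qed

text \<open>Let \<open>a\<close>, \<open>b\<close> be the demand and supply volumes of one step. The
  new state is \<open>min (x + a) S - min D b\<close>, where \<open>S\<close> is
  \<open>\<Lambda> + b\<close> (PQM1, PQM4) or \<open>\<Lambda>\<close> (PQM2, PQM3), and
  \<open>D\<close> is \<open>x + a\<close> (PQM1, PQM3) or \<open>x\<close> (PQM2, PQM4).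
  Nonnegativity is delicate only in PQM3, where it follows from \<open>b \<le> \<Lambda>\<close>;
  the upper bound only in PQM4, where for \<open>x < b\<close> the state is at most
  \<open>a\<close>.\<close>

lemma queue_update_range:
  assumes "\<Delta>t > 0" "\<delta> \<ge> 0" "\<sigma> \<ge> 0" "x \<in> {0..\<Lambda>}"
    and "m = PQM3 \<Longrightarrow> \<Delta>t * \<sigma> \<le> \<Lambda>" and "m = PQM4 \<Longrightarrow> \<Delta>t * \<delta> \<le> \<Lambda>"
  shows "queue_update m \<Lambda> \<Delta>t \<delta> \<sigma> x \<in> {0..\<Lambda>}"
proof -
  \<comment> \<open>Naming the products leaves a linear case analysis.\<close>
  define a b where "a = \<delta> * \<Delta>t" and "b = \<sigma> * \<Delta>t"
  have "a \<ge> 0" "b \<ge> 0" "m = PQM3 \<Longrightarrow> b \<le> \<Lambda>" "m = PQM4 \<Longrightarrow> a \<le> \<Lambda>"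
    using assms by (simp_all add: a_def b_def mult.commute)
  then show ?thesis
    using assms(1,4)
    by (cases m)
      (auto simp: queue_update_def inflow_def outflow_def min_def simp flip: a_def b_def)
qed

lemma well_definedI:
  assumes "\<Delta>t > 0" "nonneg_at_steps \<Delta>t \<delta>" "nonneg_at_steps \<Delta>t \<sigma>"
    and "\<And>t. m = PQM3 \<Longrightarrow> t \<in> time_steps \<Delta>t \<Longrightarrow> \<Delta>t * \<sigma> t \<le> \<Lambda>"
    and "\<And>t. m = PQM4 \<Longrightarrow> t \<in> time_steps \<Delta>t \<Longrightarrow> \<Delta>t * \<delta> t \<le> \<Lambda>"
  shows "well_defined form m \<Lambda> \<Delta>t \<delta> \<sigma>"
  unfolding well_defined_iff_update[OF assms(1)]
  using assms by (auto simp: nonneg_at_steps_def intro!: queue_update_range simp del: atLeastAtMost_iff)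

lemma well_defined_PQM3_bound:
  assumes "\<Lambda> > 0" "\<Delta>t > 0" "nonneg_at_steps \<Delta>t \<sigma>"
    and "well_defined form PQM3 \<Lambda> \<Delta>t \<sigma> \<sigma>" and t: "t \<in> time_steps \<Delta>t"
  shows "\<Delta>t * \<sigma> t \<le> \<Lambda>"
proof -
  \<comment> \<open>The full queue admits nothing, while the demand volume
    \<open>\<sigma> t * \<Delta>t + \<Lambda>\<close> lets all of
    \<open>\<sigma> t * \<Delta>t\<close> leave: the new state is
    \<open>\<Lambda> - \<sigma> t * \<Delta>t\<close>.\<close>
  have "queue_update PQM3 \<Lambda> \<Delta>t (\<sigma> t) (\<sigma> t) \<Lambda> \<in> {0..\<Lambda>}"
    using assms by (simp add: well_defined_iff_update)
  moreover have "\<sigma> t \<ge> 0" using assms by (simp add: nonneg_at_steps_def)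
  ultimately show ?thesis
    using assms(1,2) by (simp add: queue_update_def inflow_def outflow_def mult.commute)
qed

lemma well_defined_PQM4_bound:
  assumes "\<Lambda> > 0" "\<Delta>t > 0" "nonneg_at_steps \<Delta>t \<delta>"
    and "well_defined form PQM4 \<Lambda> \<Delta>t \<delta> \<delta>" and t: "t \<in> time_steps \<Delta>t"
  shows "\<Delta>t * \<delta> t \<le> \<Lambda>"
proof -
  \<comment> \<open>Nothing leaves the empty queue and all of \<open>\<delta> t * \<Delta>t\<close>
    enters, so this volume is the new state.\<close>
  have "queue_update PQM4 \<Lambda> \<Delta>t (\<delta> t) (\<delta> t) 0 \<in> {0..\<Lambda>}"
    using assms by (simp add: well_defined_iff_update)
  moreover have "\<delta> t \<ge> 0" using assms by (simp add: nonneg_at_steps_def)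
  ultimately show ?thesis
    using assms(1,2) by (simp add: queue_update_def inflow_def outflow_def mult.commute)
qed

text \<open>At \<open>c = 0\<close> both sides hold: the quotient is infinite and the product is
  0.\<close>

lemma ereal_le_divide_iff_mult_le:
  fixes a b c :: real
  assumes "b > 0" "c \<ge> 0"
  shows "ereal a \<le> ereal b / ereal c \<longleftrightarrow> a * c \<le> b"
  using assms by (cases "c = 0") (auto simp: field_simps)

lemma ereal_le_divide_SUP:
  fixes a b :: real
  assumes "a > 0" "b > 0" and nonneg: "\<And>t. t \<in> T \<Longrightarrow> f t \<ge> 0"
    and le: "ereal a \<le> ereal b / (SUP t \<in> T. ereal (f t))" and t: "t \<in> T"
  shows "a * f t \<le> b"
proof -
  let ?S = "SUP t \<in> T. ereal (f t)"
  have upper: "ereal (f t) \<le> ?S" using t by (rule SUP_upper)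
  have nonneg_t: "0 \<le> f t" using t by (rule nonneg)
  show ?thesis
  proof (cases ?S)
    case (real s)
    then have fs: "f t \<le> s" using upper by simp
    then have "a * s \<le> b"
      \<comment> \<open>\<open>ereal_divide\<close> would split the quotient before the product form
        can be matched.\<close>
      using le nonneg_t assms(2) by (simp add: real ereal_le_divide_iff_mult_le del: ereal_divide)
    moreover have "a * f t \<le> a * s" using fs \<open>a > 0\<close> by simp
    ultimately show ?thesis by linarith
  next
    \<comment> \<open>An infinite supremum makes the quotient 0, contradicting
      \<open>a > 0\<close>.\<close>
    case PInf
    with le \<open>a > 0\<close> show ?thesis by simp
  next
    case MInf
    with upper show ?thesis by simp
  qed
qed

theorem theorem3p8:
  fixes \<Lambda> \<Delta>t :: real and \<delta> \<sigma> :: "real \<Rightarrow> real" and form :: formulation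
  assumes "\<Lambda> > 0" and "\<Delta>t > 0"
    and "nonneg_at_steps \<Delta>t \<delta>" and "nonneg_at_steps \<Delta>t \<sigma>"
  shows "well_defined form PQM1 \<Lambda> \<Delta>t \<delta> \<sigma> \<and>
    well_defined form PQM2 \<Lambda> \<Delta>t \<delta> \<sigma> \<and>
    ((\<forall>\<delta>'. nonneg_at_steps \<Delta>t \<delta>' \<longrightarrow> well_defined form PQM3 \<Lambda> \<Delta>t \<delta>' \<sigma>) \<longleftrightarrow>
      (\<forall>t \<in> time_steps \<Delta>t. ereal \<Delta>t \<le> ereal \<Lambda> / ereal (\<sigma> t))) \<and>
    ((\<forall>\<sigma>'. nonneg_at_steps \<Delta>t \<sigma>' \<longrightarrow> well_defined form PQM4 \<Lambda> \<Delta>t \<delta> \<sigma>') \<longleftrightarrow>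
      (\<forall>t \<in> time_steps \<Delta>t. ereal \<Delta>t \<le> ereal \<Lambda> / ereal (\<delta> t))) \<and>
    (ereal \<Delta>t \<le> ereal \<Lambda> / (SUP t \<in> time_steps \<Delta>t. ereal (max (\<delta> t) (\<sigma> t))) \<longrightarrow>
      (\<forall>m. well_defined form m \<Lambda> \<Delta>t \<delta> \<sigma>))"
proof -
  have \<delta>: "0 \<le> \<delta> t" and \<sigma>: "0 \<le> \<sigma> t" if "t \<in> time_steps \<Delta>t" for t
    using that assms(3,4) by (simp_all add: nonneg_at_steps_def)
  have "well_defined form PQM1 \<Lambda> \<Delta>t \<delta> \<sigma>" "well_defined form PQM2 \<Lambda> \<Delta>t \<delta> \<sigma>"
    using assms by (auto intro: well_definedI)
  \<comment> \<open>Necessity comes from the instance \<open>\<delta>' = \<sigma>\<close>; for PQM4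
    below, from \<open>\<sigma>' = \<delta>\<close>.\<close>
  moreover have "(\<forall>\<delta>'. nonneg_at_steps \<Delta>t \<delta>' \<longrightarrow> well_defined form PQM3 \<Lambda> \<Delta>t \<delta>' \<sigma>) \<longleftrightarrow>
      (\<forall>t \<in> time_steps \<Delta>t. \<Delta>t * \<sigma> t \<le> \<Lambda>)"
    using assms by (auto intro: well_definedI well_defined_PQM3_bound)
  moreover have "(\<forall>\<sigma>'. nonneg_at_steps \<Delta>t \<sigma>' \<longrightarrow> well_defined form PQM4 \<Lambda> \<Delta>t \<delta> \<sigma>') \<longleftrightarrow>
      (\<forall>t \<in> time_steps \<Delta>t. \<Delta>t * \<delta> t \<le> \<Lambda>)"
    using assms by (auto intro: well_definedI well_defined_PQM4_bound)
  moreover have "well_defined form m \<Lambda> \<Delta>t \<delta> \<sigma>"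
    if le: "ereal \<Delta>t \<le> ereal \<Lambda> / (SUP t \<in> time_steps \<Delta>t. ereal (max (\<delta> t) (\<sigma> t)))" for m
  proof -
    have "\<Delta>t * \<delta> t \<le> \<Lambda> \<and> \<Delta>t * \<sigma> t \<le> \<Lambda>" if t: "t \<in> time_steps \<Delta>t" for t
    proof -
      have "\<Delta>t * max (\<delta> t) (\<sigma> t) \<le> \<Lambda>"
        using ereal_le_divide_SUP[OF assms(2,1) _ le t] \<delta> by (simp add: le_max_iff_disj)
      moreover have "\<Delta>t * \<delta> t \<le> \<Delta>t * max (\<delta> t) (\<sigma> t)" "\<Delta>t * \<sigma> t \<le> \<Delta>t * max (\<delta> t) (\<sigma> t)"
        using assms(2) by simp_all
      ultimately show ?thesis by linarith
    qed
    then show ?thesis using assms by (intro well_definedI) auto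
  qed
  ultimately show ?thesis
    using assms(1) \<delta> \<sigma> by (simp add: ereal_le_divide_iff_mult_le del: ereal_divide)
qed

end
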